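(* Let $a>0$ and $b_1\neq 0$ be relatively prime integers with $\Delta=a^{2}-4b_1^{2}\neq 0$, and put $b=-b_1^{2}$. Then for every $n\ge 0$, \[ u_{2n+1}(a,-b_1^{2})=t_n(a,-b_1^{2})\,w_n(a,-b_1^{2}). \] Furthermore, this is the Aurifeuillean factorisation of $u_{2n+1}(a,-b_1^2)$, that is, the factorisation obtained by substituting $x=\alpha$, $y=\beta$ (with $\alpha\beta=b_1^{2}$, taking $\sqrt{\alpha\beta}=b_1$) in the identity \[ \frac{x^{2n+1}-y^{2n+1}}{x-y}=\left(\frac{x^{n+1}-y^{n+1}}{x-y}\right)^{2}-xy\left(\frac{x^{n}-y^{n}}{x-y}\right)^{2} \] and factoring the right-hand side as a difference of two squares; explicitly, \[ t_n(a,-b_1^{2})=\frac{\alpha^{n+1}-\beta^{n+1}}{\alpha-\beta}-b_1\frac{\alpha^{n}-\beta^{n}}{\alpha-\beta},\qquad w_n(a,-b_1^{2})=\frac{\alpha^{n+1}-\beta^{n+1}}{\alpha-\beta}+b_1\frac{\alpha^{n}-\beta^{n}}{\alpha-\beta}. \]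
   Context: Here $\alpha=\frac{a+\sqrt{\Delta}}{2}$ and $\beta=\frac{a-\sqrt{\Delta}}{2}$ are the roots of $X^{2}-aX+b_1^{2}$. With $b=-b_1^{2}$, the sequences $(u_n(a,b))_{n\ge0}$, $(t_n(a,b))_{n\ge0}$ and $(w_n(a,b))_{n\ge0}$ all satisfy the recurrence $x_{n+2}=a\,x_{n+1}+b\,x_n$ for $n\ge 0$, with initial values $u_0=0,\ u_1=1$; $t_0=1,\ t_1=a-b_1$; $w_0=1,\ w_1=a+b_1$. *)

theory Defs
  imports Complex_Main "HOL-Computational_Algebra.Polynomial"
begin

fun binrec :: "int \<Rightarrow> int \<Rightarrow> int \<Rightarrow> int \<Rightarrow> nat \<Rightarrow> int" where
  "binrec a b x0 x1 0 = x0"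
| "binrec a b x0 x1 (Suc 0) = x1"
| "binrec a b x0 x1 (Suc (Suc n)) = a * binrec a b x0 x1 (Suc n) + b * binrec a b x0 x1 n"

definition u_seq :: "int \<Rightarrow> int \<Rightarrow> nat \<Rightarrow> int" where
  "u_seq a b = binrec a b 0 1"

(* The initial values of t and w involve b1 itself, not only b = - b1^2, which determines
   b1 merely up to sign; so t_n(a, - b1^2) and w_n(a, - b1^2) are written t_seq a b1 n
   and w_seq a b1 n. *)

definition t_seq :: "int \<Rightarrow> int \<Rightarrow> nat \<Rightarrow> int" where
  "t_seq a b1 = binrec a (- (b1 ^ 2)) 1 (a - b1)"

definition w_seq :: "int \<Rightarrow> int \<Rightarrow> nat \<Rightarrow> int" where
  "w_seq a b1 = binrec a (- (b1 ^ 2)) 1 (a + b1)"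

definition discr :: "int \<Rightarrow> int \<Rightarrow> int" where
  "discr a b1 = a ^ 2 - 4 * b1 ^ 2"

(* The discriminant may be negative, so the roots are complex; csqrt is the principal
   square root (for a positive discriminant, the usual real one). *)

definition alpha :: "int \<Rightarrow> int \<Rightarrow> complex" where
  "alpha a b1 = (of_int a + csqrt (of_int (discr a b1))) / 2"

definition beta :: "int \<Rightarrow> int \<Rightarrow> complex" where
  "beta a b1 = (of_int a - csqrt (of_int (discr a b1))) / 2"

(* Meaningful only for x \<noteq> y: for x = y, division by zero gives 0 rather than
   k * x^(k-1). *)

definition diffquot :: "complex \<Rightarrow> complex \<Rightarrow> nat \<Rightarrow> complex" where
  "diffquot x y k = (x ^ k - y ^ k) / (x - y)"

end

theory Submission
  imports Defs
begin

text \<open>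
  Write \<open>D k = (x ^ k - y ^ k) / (x - y)\<close> for the roots \<open>x\<close>, \<open>y\<close> of \<open>X\<^sup>2 - a X - b\<close>.
  The sequence \<open>D\<close> satisfies the same second-order recurrence as \<open>u\<close>, \<open>t\<close> and \<open>w\<close>, and so does
  its shift. Every solution of the recurrence is therefore a combination of \<open>D n\<close> and
  \<open>D (n + 1)\<close>, and the two initial values determine the coefficients
  (\<open>binrec_eq_diffquot\<close>). This yields \<open>u\<^sub>n = D n\<close> and \<open>D (n + 1) \<mp> b1 * D n\<close> for \<open>t\<^sub>n\<close> and
  \<open>w\<^sub>n\<close>.

  With \<open>x y = b1\<^sup>2\<close>, the identity \<open>D (2 n + 1) = (D (n + 1))\<^sup>2 - x y (D n)\<^sup>2\<close>
  (\<open>diffquot_odd\<close>) has a difference of two squares on the right, whose factors are exactly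
  \<open>t\<^sub>n\<close> and \<open>w\<^sub>n\<close>. The integer factorisation of \<open>u\<^sub>2\<^sub>n\<^sub>+\<^sub>1\<close> is this complex one, pulled back along
  the injection of the integers into the complex numbers.
\<close>

lemma diffquot_Suc_Suc:
  "diffquot x y (Suc (Suc n)) = (x + y) * diffquot x y (Suc n) - x * y * diffquot x y n"
proof -
  have "x ^ Suc (Suc n) - y ^ Suc (Suc n)
      = (x + y) * (x ^ Suc n - y ^ Suc n) - x * y * (x ^ n - y ^ n)"
    by (simp add: algebra_simps)
  then show ?thesis
    by (simp only: diffquot_def times_divide_eq_right flip: diff_divide_distrib)
qed

lemma diffquot_0 [simp]: "diffquot x y 0 = 0"
  and diffquot_1 [simp]: "x \<noteq> y \<Longrightarrow> diffquot x y (Suc 0) = 1"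
  by (simp_all add: diffquot_def)

text \<open>
  The sequences \<open>n \<mapsto> D n\<close> and \<open>n \<mapsto> D (n + 1)\<close> begin \<open>0, 1\<close> and \<open>1, a\<close>, so they form a basis
  of the solution space, and comparing the values at \<open>0\<close> and \<open>1\<close> gives the coefficients.
\<close>

lemma binrec_eq_diffquot:
  assumes "x \<noteq> y" and sum: "x + y = of_int a" and prod: "x * y = - of_int b"
  shows "of_int (binrec a b x0 x1 n)
    = of_int x0 * diffquot x y (Suc n) + of_int (x1 - a * x0) * diffquot x y n"
proof (induction n rule: less_induct)
  case (less n)
  consider "n = 0" | "n = Suc 0" | m where "n = Suc (Suc m)"
    by (metis not0_implies_Suc)
  then show ?case
  proof cases
    case 1
    then show ?thesis using \<open>x \<noteq> y\<close> by simp
  next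
    case 2
    have "diffquot x y (Suc (Suc 0)) = of_int a"
      using \<open>x \<noteq> y\<close> by (simp add: diffquot_Suc_Suc sum)
    then show ?thesis using 2 \<open>x \<noteq> y\<close> by simp
  next
    case 3
    note rec = diffquot_Suc_Suc[of x y, unfolded sum prod]
    have IH: "of_int (binrec a b x0 x1 k)
        = of_int x0 * diffquot x y (Suc k) + of_int (x1 - a * x0) * diffquot x y k"
      if "k = m \<or> k = Suc m" for k
      using that 3 by (intro less.IH) auto
    have "of_int (binrec a b x0 x1 n)
        = of_int a * (of_int (binrec a b x0 x1 (Suc m)) :: complex)
          + of_int b * of_int (binrec a b x0 x1 m)"
      by (simp add: 3)
    also have "\<dots> = of_int x0 * diffquot x y (Suc n) + of_int (x1 - a * x0) * diffquot x y n"
      unfolding IH[of m, simplified] IH[of "Suc m", simplified] 3 rec[of "Suc m"]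
      by (simp add: algebra_simps rec[of m])
    finally show ?thesis .
  qed
qed

text \<open>
  After clearing the denominator \<open>(x - y)\<^sup>2\<close> and writing \<open>p = x ^ n\<close>, \<open>q = y ^ n\<close>, the
  identity becomes \<open>(x p\<^sup>2 - y q\<^sup>2) (x - y) = (x p - y q)\<^sup>2 - x y (p - q)\<^sup>2\<close>: on the right the
  mixed terms in \<open>p q\<close> cancel.
\<close>

lemma diffquot_odd:
  assumes "x \<noteq> y"
  shows "diffquot x y (2 * n + 1) = (diffquot x y (n + 1))\<^sup>2 - x * y * (diffquot x y n)\<^sup>2"
proof -
  define p q where "p = x ^ n" and "q = y ^ n"
  have pow: "x ^ (2 * n + 1) = x * p\<^sup>2" "y ^ (2 * n + 1) = y * q\<^sup>2"
    "x ^ (n + 1) = x * p" "y ^ (n + 1) = y * q"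
    by (simp_all add: p_def q_def power_even_eq)
  have "(x * p\<^sup>2 - y * q\<^sup>2) * (x - y) = (x * p - y * q)\<^sup>2 - x * y * (p - q)\<^sup>2"
    by algebra
  then have "(x * p\<^sup>2 - y * q\<^sup>2) / (x - y)
      = ((x * p - y * q)\<^sup>2 - x * y * (p - q)\<^sup>2) / (x - y)\<^sup>2"
    using assms by (simp add: divide_simps power2_eq_square)
  then show ?thesis
    unfolding diffquot_def pow p_def[symmetric] q_def[symmetric] power_divide
      times_divide_eq_right diff_divide_distrib[symmetric] .
qed

lemma alpha_plus_beta: "alpha a b1 + beta a b1 = of_int a"
  by (simp add: alpha_def beta_def field_simps)

lemma alpha_times_beta: "alpha a b1 * beta a b1 = (of_int b1)\<^sup>2"
proof -
  have "alpha a b1 * beta a b1 = ((of_int a)\<^sup>2 - (csqrt (of_int (discr a b1)))\<^sup>2) / 4"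
    by (simp add: alpha_def beta_def algebra_simps power2_eq_square)
  then show ?thesis
    by (simp add: discr_def)
qed

lemma alpha_neq_beta:
  assumes "discr a b1 \<noteq> 0"
  shows "alpha a b1 \<noteq> beta a b1"
proof -
  have "alpha a b1 - beta a b1 = csqrt (of_int (discr a b1))"
    by (simp add: alpha_def beta_def field_simps)
  also have "\<dots> \<noteq> 0"
    unfolding csqrt_eq_0 of_int_eq_0_iff by (fact assms)
  finally show ?thesis
    by simp
qed

theorem lemma3p1:
  fixes a b1 :: int
  assumes "a > 0" and "b1 \<noteq> 0" and "coprime a b1" and "discr a b1 \<noteq> 0"
  shows "(\<forall>n. u_seq a (- (b1 ^ 2)) (2 * n + 1) = t_seq a b1 n * w_seq a b1 n)
    \<and> [: of_int (b1 ^ 2), - of_int a, 1 :] = [: - alpha a b1, 1 :] * [: - beta a b1, 1 :]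
    \<and> alpha a b1 \<noteq> beta a b1
    \<and> alpha a b1 * beta a b1 = (of_int b1) ^ 2
    \<and> (\<forall>n x y. x \<noteq> y \<longrightarrow>
         diffquot x y (2 * n + 1) = (diffquot x y (n + 1)) ^ 2 - x * y * (diffquot x y n) ^ 2)
    \<and> (\<forall>n. let x = alpha a b1; y = beta a b1 in
         of_int (u_seq a (- (b1 ^ 2)) (2 * n + 1)) = diffquot x y (2 * n + 1)
         \<and> diffquot x y (2 * n + 1) = (diffquot x y (n + 1)) ^ 2 - x * y * (diffquot x y n) ^ 2
         \<and> (diffquot x y (n + 1)) ^ 2 - x * y * (diffquot x y n) ^ 2
             = (diffquot x y (n + 1) - of_int b1 * diffquot x y n)
               * (diffquot x y (n + 1) + of_int b1 * diffquot x y n)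
         \<and> of_int (t_seq a b1 n) = diffquot x y (n + 1) - of_int b1 * diffquot x y n
         \<and> of_int (w_seq a b1 n) = diffquot x y (n + 1) + of_int b1 * diffquot x y n)"
proof -
  define x y where "x = alpha a b1" and "y = beta a b1"
  have sum: "x + y = of_int a" and prod: "x * y = (of_int b1)\<^sup>2" and neq: "x \<noteq> y"
    using alpha_plus_beta alpha_times_beta alpha_neq_beta assms(4)
    by (simp_all add: x_def y_def)
  have prod': "x * y = - of_int (- (b1 ^ 2))"
    using prod by simp
  note binet = binrec_eq_diffquot[OF neq sum prod']
  have u: "of_int (u_seq a (- (b1 ^ 2)) n) = diffquot x y n" for n
    unfolding u_seq_def binet by simp
  have t: "of_int (t_seq a b1 n) = diffquot x y (n + 1) - of_int b1 * diffquot x y n" for n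
    unfolding t_seq_def binet by simp
  have w: "of_int (w_seq a b1 n) = diffquot x y (n + 1) + of_int b1 * diffquot x y n" for n
    unfolding w_seq_def binet by simp
  have squares: "(diffquot x y (n + 1)) ^ 2 - x * y * (diffquot x y n) ^ 2
      = (diffquot x y (n + 1) - of_int b1 * diffquot x y n)
        * (diffquot x y (n + 1) + of_int b1 * diffquot x y n)" for n
    unfolding prod by algebra
  have fact: "u_seq a (- (b1 ^ 2)) (2 * n + 1) = t_seq a b1 n * w_seq a b1 n" for n
  proof -
    have "(of_int (u_seq a (- (b1 ^ 2)) (2 * n + 1)) :: complex)
        = of_int (t_seq a b1 n * w_seq a b1 n)"
      unfolding of_int_mult u t w diffquot_odd[OF neq] squares ..
    then show ?thesis
      by (simp only: of_int_eq_iff)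
  qed
  have poly: "[: of_int (b1 ^ 2), - of_int a, 1 :] = [: - x, 1 :] * [: - y, 1 :]"
    using prod by (simp add: algebra_simps flip: sum)
  show ?thesis
    unfolding Let_def x_def[symmetric] y_def[symmetric]
    using fact poly neq prod diffquot_odd u t w squares by blast
qed

end
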